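(* Let $G_n\sim G(n,1/2)$ be an Erdős–Rényi random graph on $n$ vertices. Then $\mathbb{E}[b^A_g(G_n)+b^I_g(G_n)]=\mathbb{E}[b^A_g(G_n)+b^I_g(\overline{G_n})]=\lfloor n/2\rfloor$.
   Context: $G(n,1/2)$ is the random graph on vertex set $\{1,\dots,n\}$ in which each of the $\binom n2$ possible edges is present independently with probability $1/2$; $\overline{G_n}$ is the complement of $G_n$. The balance game on a finite simple graph $G$ is played by two players, Admirable (A) and Impish (I), who alternately select a not-yet-labeled vertex of $G$ until all vertices are labeled; Admirable labels each vertex she selects by $0$ and Impish labels each vertex he selects by $1$. Each edge receives the sum modulo $2$ of the labels of its endpoints. Let $e_0$ and $e_1$ be the numbers of edges labeled $0$ and $1$ at the end; the discrepancy is $d=e_1-e_0$. Admirable tries to minimize $d$ and Impish tries to maximize $d$. $b^A_g(G)$ is the value of $d$ under optimal play when Admirable moves first, and $b^I_g(G)$ is the value under optimal play when Impish moves first. *)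

theory Defs
  imports "HOL-Probability.Probability" "HOL-Library.Ramsey"
begin

text \<open>Edges are two-element sets of vertices; \<open>[V]\<^bsup>2\<^esup>\<close> is the set of all such subsets of \<open>V\<close>.\<close>

record 'v graph =
  verts :: "'v set"
  edges :: "'v set set"

definition finite_simple_graph :: "'v graph \<Rightarrow> bool" where
  "finite_simple_graph G \<longleftrightarrow> finite (verts G) \<and> edges G \<subseteq> [verts G]\<^bsup>2\<^esup>"

definition complement :: "'v graph \<Rightarrow> 'v graph" where
  "complement G = \<lparr>verts = verts G, edges = [verts G]\<^bsup>2\<^esup> - edges G\<rparr>"

datatype player = Admirable | Impish

fun opponent :: "player \<Rightarrow> player" where
  "opponent Admirable = Impish"
| "opponent Impish = Admirable"

fun mark :: "player \<Rightarrow> nat" where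
  "mark Admirable = 0"
| "mark Impish = 1"

definition edge_label :: "('v \<Rightarrow> nat) \<Rightarrow> 'v set \<Rightarrow> nat" where
  "edge_label l e = (\<Sum>v\<in>e. l v) mod 2"

definition discrepancy :: "'v graph \<Rightarrow> ('v \<Rightarrow> nat) \<Rightarrow> int" where
  "discrepancy G l =
     int (card {e \<in> edges G. edge_label l e = 1}) - int (card {e \<in> edges G. edge_label l e = 0})"

fun optimum :: "player \<Rightarrow> int set \<Rightarrow> int" where
  "optimum Admirable S = Min S"
| "optimum Impish S = Max S"

text \<open>
  \<open>game_value G P l\<close> is the value of the discrepancy under optimal play of both players, starting
  from the position in which \<open>dom l\<close> is the set of vertices already labeled, with labels given by
  \<open>l\<close>, and in which it is the turn of player \<open>P\<close>.  The finiteness test only serves termination.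
\<close>

function game_value :: "'v graph \<Rightarrow> player \<Rightarrow> ('v \<rightharpoonup> nat) \<Rightarrow> int" where
  "game_value G P l =
     (if finite (verts G) \<and> verts G - dom l \<noteq> {}
      then optimum P
             ((\<lambda>v. game_value G (opponent P) (l(v \<mapsto> mark P))) ` (verts G - dom l))
      else discrepancy G (\<lambda>v. the (l v)))"
  by auto
termination
proof (relation "Wellfounded.measure (\<lambda>(G, P, l). card (verts G - dom l))", goal_cases)
  case 1
  show ?case by simp
next
  case (2 G P l v)
  then have "verts G - dom (l(v \<mapsto> mark P)) \<subset> verts G - dom l"
    by auto
  with 2 show ?case
    by (simp add: psubset_card_mono del: dom_fun_upd)
qed

declare game_value.simps [simp del]

definition balance_A :: "'v graph \<Rightarrow> int" where
  "balance_A G = game_value G Admirable Map.empty"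

definition balance_I :: "'v graph \<Rightarrow> int" where
  "balance_I G = game_value G Impish Map.empty"

text \<open>
  \<open>Pi_pmf\<close> is the product distribution, so the coins of distinct edges are independent; \<open>False\<close>
  is merely the value outside of the index set.  A \<open>p\<close> outside of \<open>[0, 1]\<close> is clipped by
  \<open>bernoulli_pmf\<close>.
\<close>

definition random_graph :: "nat \<Rightarrow> real \<Rightarrow> nat graph pmf" where
  "random_graph n p =
     map_pmf (\<lambda>X. \<lparr>verts = {1..n}, edges = {e \<in> [{1..n}]\<^bsup>2\<^esup>. X e}\<rparr>)
       (Pi_pmf ([{1..n}]\<^bsup>2\<^esup>) False (\<lambda>_. bernoulli_pmf p))"

lemma finite_simple_graph_random_graph:
  "G \<in> set_pmf (random_graph n p) \<Longrightarrow> finite_simple_graph G"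
  by (auto simp: random_graph_def finite_simple_graph_def)

end

theory Submission
  imports Defs
begin

text \<open>
  The player who minimizes the discrepancy on \<open>G\<close> maximizes it on the complement: at the end of the
  game the two label classes differ in size by at most one, so the discrepancies of \<open>G\<close> and of its
  complement add up to that of the complete graph, which is \<open>n div 2\<close>. Exchanging the labels leaves
  the edge labels unchanged, hence \<open>balance_A G + balance_I (complement G) = n div 2\<close> for every
  graph. Finally, the complement of a random graph with edge probability \<open>1/2\<close> has the same
  distribution as the graph itself.
\<close>

section \<open>Exchange of the labels and of the players\<close>

definition flip_labels :: "('v \<rightharpoonup> nat) \<Rightarrow> ('v \<rightharpoonup> nat)" where
  "flip_labels l = (\<lambda>v. map_option (\<lambda>k. 1 - k) (l v))"

lemma dom_flip_labels [simp]: "dom (flip_labels l) = dom l"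
  by (auto simp: flip_labels_def)

lemma flip_labels_empty [simp]: "flip_labels Map.empty = Map.empty"
  by (simp add: flip_labels_def)

lemma flip_labels_upd:
  "flip_labels (l(v \<mapsto> mark P)) = (flip_labels l)(v \<mapsto> mark (opponent P))"
  by (cases P) (auto simp: flip_labels_def)

lemma opponent_opponent [simp]: "opponent (opponent P) = P"
  by (cases P) auto

lemma verts_complement [simp]: "verts (complement G) = verts G"
  by (simp add: complement_def)

text \<open>The map \<open>x \<mapsto> c - x\<close> reverses the order, so it turns minima into
  maxima and conversely; \<open>S\<close> must be finite and nonempty for them to be
  attained.\<close>

lemma optimum_reflect:
  assumes "finite S" "S \<noteq> {}"
  shows "optimum (opponent P) ((\<lambda>x. c - x) ` S) = c - optimum P S"
proof (cases P)
  case Admirable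
  have "Max ((\<lambda>x. c - x) ` S) = c - Min S"
    using assms by (intro Max_eqI) (auto intro!: imageI Min_in)
  then show ?thesis using Admirable by simp
next
  case Impish
  have "Min ((\<lambda>x. c - x) ` S) = c - Max S"
    using assms by (intro Min_eqI) (auto intro!: imageI Max_in)
  then show ?thesis using Impish by simp
qed

text \<open>Exchanging 0 and 1 at both endpoints turns the sum \<open>s\<close> of the two labels
  into \<open>2 - s\<close>, which has the same parity.\<close>

lemma edge_label_flip:
  assumes "e \<in> [V]\<^bsup>2\<^esup>" "\<And>v. v \<in> V \<Longrightarrow> f v \<le> 1" "\<And>v. v \<in> V \<Longrightarrow> g v = 1 - f v"
  shows "edge_label g e = edge_label f e"
proof -
  obtain u v where e: "e = {u, v}" "u \<noteq> v" "u \<in> V" "v \<in> V"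
    using assms(1) by (auto simp: nsets_def card_2_iff)
  have "f u = 0 \<or> f u = 1" "f v = 0 \<or> f v = 1"
    using assms(2)[of u] assms(2)[of v] e by auto
  then show ?thesis using e assms(3) by (auto simp: edge_label_def)
qed

section \<open>Discrepancies of a graph, its complement and the complete graph\<close>

lemma discrepancy_cong:
  assumes "\<And>e. e \<in> edges G \<Longrightarrow> edge_label f e = edge_label g e"
  shows "discrepancy G f = discrepancy G g"
proof -
  have "{e \<in> edges G. edge_label f e = k} = {e \<in> edges G. edge_label g e = k}" for k
    using assms by auto
  then show ?thesis by (simp add: discrepancy_def)
qed

lemma discrepancy_add_complement:
  assumes "finite_simple_graph G"
  shows "discrepancy G f + discrepancy (complement G) f =
    discrepancy \<lparr>verts = verts G, edges = [verts G]\<^bsup>2\<^esup>\<rparr> f"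
proof -
  let ?N = "[verts G]\<^bsup>2\<^esup>"
  have fin: "finite ?N" and sub: "edges G \<subseteq> ?N"
    using assms by (auto simp: finite_simple_graph_def intro: finite_imp_finite_nsets)
  have split: "card {e \<in> ?N. edge_label f e = k} =
      card {e \<in> edges G. edge_label f e = k} + card {e \<in> ?N - edges G. edge_label f e = k}" for k
  proof -
    have "{e \<in> ?N. edge_label f e = k} =
        {e \<in> edges G. edge_label f e = k} \<union> {e \<in> ?N - edges G. edge_label f e = k}"
      using sub by auto
    then show ?thesis
      using fin finite_subset[OF sub fin] by (simp add: card_Un_disjoint disjoint_iff)
  qed
  show ?thesis by (simp add: discrepancy_def complement_def split)
qed

text \<open>Let a vertices have label 0 and b have label 1. Then ab of the (a + b)(a + b - 1)/2
  edges are labeled 1, so twice the discrepancy is 4ab - (a + b)(a + b - 1) = (a + b) - (a -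
  b)^2.\<close>

lemma discrepancy_complete:
  fixes f :: "'v \<Rightarrow> nat"
  assumes "finite V" "\<And>v. v \<in> V \<Longrightarrow> f v \<le> 1"
    and "\<bar>int (card {v \<in> V. f v = 0}) - int (card {v \<in> V. f v = 1})\<bar> \<le> 1"
  shows "discrepancy \<lparr>verts = V, edges = [V]\<^bsup>2\<^esup>\<rparr> f = int (card V div 2)"
proof -
  define A where "A = {v \<in> V. f v = 0}"
  define B where "B = {v \<in> V. f v = 1}"
  have fin: "finite A" "finite B" using assms(1) by (auto simp: A_def B_def)
  have V: "V = A \<union> B" "A \<inter> B = {}"
    using assms(2) by (auto simp: A_def B_def le_Suc_eq)
  have cV: "card V = card A + card B"
    using V fin by (simp add: card_Un_disjoint)
  let ?E = "\<lambda>k. {e \<in> [V]\<^bsup>2\<^esup>. edge_label f e = k}"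
  have finN: "finite ([V]\<^bsup>2\<^esup>)" using assms(1) by (rule finite_imp_finite_nsets)
  \<comment> \<open>An edge has label 1 exactly if it joins the two label classes.\<close>
  have "?E 1 = (\<lambda>(u, v). {u, v}) ` (A \<times> B)"
  proof (intro equalityI subsetI)
    fix e assume "e \<in> ?E 1"
    then obtain u v where e: "e = {u, v}" "u \<noteq> v" "u \<in> V" "v \<in> V" "edge_label f e = 1"
      by (auto simp: nsets_def card_2_iff)
    have "f u = 0 \<or> f u = 1" "f v = 0 \<or> f v = 1"
      using assms(2)[of u] assms(2)[of v] e by auto
    then have "u \<in> A \<and> v \<in> B \<or> v \<in> A \<and> u \<in> B"
      using e by (auto simp: edge_label_def A_def B_def)
    then show "e \<in> (\<lambda>(u, v). {u, v}) ` (A \<times> B)"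
      using e(1) by (auto simp: image_iff insert_commute)
  next
    fix e assume "e \<in> (\<lambda>(u, v). {u, v}) ` (A \<times> B)"
    then obtain u v where "e = {u, v}" "u \<in> A" "v \<in> B" by auto
    moreover from this have "u \<noteq> v" using V by auto
    ultimately show "e \<in> ?E 1"
      by (auto simp: nsets_def A_def B_def edge_label_def)
  qed
  \<comment> \<open>As \<open>A\<close> and \<open>B\<close> are disjoint, an edge between them
    determines which endpoint lies in which class.\<close>
  moreover have "inj_on (\<lambda>(u, v). {u, v}) (A \<times> B)"
    using V by (auto simp: inj_on_def doubleton_eq_iff)
  ultimately have c1: "card (?E 1) = card A * card B"
    by (simp add: card_image card_cartesian_product)
  have "edge_label f e = 0 \<or> edge_label f e = 1" for e
    by (auto simp: edge_label_def)
  then have "[V]\<^bsup>2\<^esup> = ?E 0 \<union> ?E 1" by blast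
  moreover have "card (?E 0 \<union> ?E 1) = card (?E 0) + card (?E 1)"
    using finN by (intro card_Un_disjoint) auto
  ultimately have "card (?E 0) + card (?E 1) = card ([V]\<^bsup>2\<^esup>)" by simp
  also have "card ([V]\<^bsup>2\<^esup>) = card V choose 2"
    by (rule card_nsets)
  finally have c01: "2 * (card (?E 0) + card (?E 1)) = card V * (card V - 1)"
    by (auto simp: choose_two intro!: dvd_mult_div_cancel)
  \<comment> \<open>The natural-number difference \<open>card V - 1\<close> is truncated for empty
    \<open>V\<close>, hence the case distinction.\<close>
  have c01: "2 * (int (card (?E 0)) + int (card (?E 1))) = int (card V) * (int (card V) - 1)"
  proof (cases "card V = 0")
    case False
    then show ?thesis using arg_cong[OF c01, of int] by (simp add: of_nat_diff)
  qed (use c01 in simp)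
  have diff: "int (card A) = int (card B) \<or> int (card A) = int (card B) + 1 \<or>
      int (card B) = int (card A) + 1"
    using assms(3) unfolding A_def[symmetric] B_def[symmetric] by linarith
  have "2 * (int (card (?E 1)) - int (card (?E 0))) =
      4 * (int (card A) * int (card B)) - int (card V) * (int (card V) - 1)"
    using c01 c1 by simp
  also have "\<dots> = int (card V) - (int (card A) - int (card B))\<^sup>2"
    unfolding cV by (simp add: algebra_simps power2_eq_square)
  finally have "2 * (int (card (?E 1)) - int (card (?E 0))) =
    int (card A) + int (card B) - (int (card A) - int (card B))\<^sup>2" by (simp add: cV)
  \<comment> \<open>The square is 0 or 1 and has the parity of \<open>card V\<close>, so subtracting
    it and halving rounds \<open>card V\<close> / 2 down.\<close>
  then have "int (card (?E 1)) - int (card (?E 0)) = int (card V) div 2"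
    using diff cV by auto
  then show ?thesis by (simp add: discrepancy_def zdiv_int)
qed

section \<open>Mirroring the game on the complement\<close>

definition class_size :: "('v \<rightharpoonup> nat) \<Rightarrow> player \<Rightarrow> nat" where
  "class_size l P = card {v. l v = Some (mark P)}"

lemma class_size_upd:
  assumes "finite (dom l)" "v \<notin> dom l"
  shows "class_size (l(v \<mapsto> mark P)) P = Suc (class_size l P)"
    and "class_size (l(v \<mapsto> mark P)) (opponent P) = class_size l (opponent P)"
proof -
  have fin: "finite {w. l w = Some (mark P)}"
    by (rule finite_subset[OF _ assms(1)]) auto
  have "{w. (l(v \<mapsto> mark P)) w = Some (mark P)} = insert v {w. l w = Some (mark P)}" by auto
  moreover have "v \<notin> {w. l w = Some (mark P)}" using assms(2) by auto
  ultimately show "class_size (l(v \<mapsto> mark P)) P = Suc (class_size l P)"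
    using fin by (simp add: class_size_def del: fun_upd_apply)
  have "{w. (l(v \<mapsto> mark P)) w = Some (mark (opponent P))} = {w. l w = Some (mark (opponent P))}"
    using assms(2) by (cases P) auto
  then show "class_size (l(v \<mapsto> mark P)) (opponent P) = class_size l (opponent P)"
    by (simp add: class_size_def del: fun_upd_apply)
qed

lemma discrepancy_add_complement_flip:
  assumes G: "finite_simple_graph G" and l: "dom l = verts G" "ran l \<subseteq> {0, 1}"
    and sizes: "\<bar>int (class_size l Admirable) - int (class_size l Impish)\<bar> \<le> 1"
  shows "discrepancy G (\<lambda>v. the (l v)) + discrepancy (complement G) (\<lambda>v. the (flip_labels l v)) =
    int (card (verts G) div 2)"
proof -
  have some: "\<exists>k\<le>1. l v = Some k" if "v \<in> verts G" for v
  proof -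
    have "v \<in> dom l" using l(1) that by simp
    from domD[OF this] obtain k where k: "l v = Some k" ..
    then have "k \<in> ran l" by (rule ranI)
    then show ?thesis using l(2) k by auto
  qed
  have le1: "the (l v) \<le> 1" if "v \<in> verts G" for v
    using some[OF that] by auto
  have "edge_label (\<lambda>v. the (flip_labels l v)) e = edge_label (\<lambda>v. the (l v)) e"
    if "e \<in> edges (complement G)" for e
  proof (rule edge_label_flip)
    show "e \<in> [verts G]\<^bsup>2\<^esup>" using that by (simp add: complement_def)
    show "the (flip_labels l v) = 1 - the (l v)" if "v \<in> verts G" for v
      using some[OF that] by (auto simp: flip_labels_def)
  qed (rule le1)
  then have "discrepancy (complement G) (\<lambda>v. the (flip_labels l v)) =
      discrepancy (complement G) (\<lambda>v. the (l v))"
    by (rule discrepancy_cong)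
  moreover have "{v \<in> verts G. the (l v) = k} = {v. l v = Some k}" for k
    by (auto simp flip: l(1))
  then have "discrepancy \<lparr>verts = verts G, edges = [verts G]\<^bsup>2\<^esup>\<rparr> (\<lambda>v. the (l v)) =
      int (card (verts G) div 2)"
    using G sizes le1
    by (intro discrepancy_complete) (auto simp: class_size_def finite_simple_graph_def)
  ultimately show ?thesis using discrepancy_add_complement[OF G] by simp
qed

text \<open>Every move on \<open>G\<close> is mirrored by the other player choosing the same vertex
  of the complement, and the induction follows both games at once. The bounds on
  \<open>class_size\<close> say that the player to move is level with the opponent or one move
  behind, so the final classes differ by at most one.\<close>

lemma game_value_add_complement:
  assumes "finite_simple_graph G" "dom l \<subseteq> verts G" "ran l \<subseteq> {0, 1}"
    and "class_size l P \<le> class_size l (opponent P)"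
    and "class_size l (opponent P) \<le> Suc (class_size l P)"
  shows "game_value G P l + game_value (complement G) (opponent P) (flip_labels l) =
    int (card (verts G) div 2)"
  using assms
proof (induction G P l rule: game_value.induct)
  case (1 G P l)
  let ?c = "int (card (verts G) div 2)"
  let ?U = "verts G - dom l"
  have fin: "finite (verts G)" using 1 by (simp add: finite_simple_graph_def)
  show ?case
  proof (cases "?U = {}")
    case True
    then have dom: "dom l = verts G" using 1(3) by auto
    then have end_G: "game_value G P l = discrepancy G (\<lambda>v. the (l v))"
      by (subst game_value.simps) simp
    have end_H: "game_value (complement G) (opponent P) (flip_labels l) =
        discrepancy (complement G) (\<lambda>v. the (flip_labels l v))"
      using dom by (subst game_value.simps) simp
    have "\<bar>int (class_size l Admirable) - int (class_size l Impish)\<bar> \<le> 1"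
      using 1(5,6) by (cases P) auto
    then show ?thesis
      unfolding end_G end_H by (rule discrepancy_add_complement_flip[OF 1(2) dom 1(4)])
  next
    case False
    let ?g = "\<lambda>v. game_value G (opponent P) (l(v \<mapsto> mark P))"
    let ?h = "\<lambda>v. game_value (complement G) P ((flip_labels l)(v \<mapsto> mark (opponent P)))"
    have finl: "finite (dom l)" using fin 1(3) by (rule finite_subset[rotated])
    \<comment> \<open>Flipping the position after a move of \<open>P\<close> is the same as letting
      the opponent move at \<open>v\<close> in the flipped position.\<close>
    have step: "?h v = ?c - ?g v" if v: "v \<in> ?U" for v
    proof -
      have "?g v + game_value (complement G) (opponent (opponent P))
          (flip_labels (l(v \<mapsto> mark P))) = ?c"
      proof (rule 1(1))
        show "dom (l(v \<mapsto> mark P)) \<subseteq> verts G" using 1(3) v by auto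
        show "ran (l(v \<mapsto> mark P)) \<subseteq> {0, 1}"
          using 1(4) v by (cases P) (auto simp: ran_def split: if_splits)
      \<comment> \<open>After the move of \<open>P\<close> the two size bounds trade places: the old
        upper bound becomes the new lower one.\<close>
      qed (use 1(2,5,6) v fin class_size_upd[OF finl, of v P]
          in \<open>auto simp del: fun_upd_apply\<close>)
      then show ?thesis by (simp add: flip_labels_upd)
    qed
    have "game_value (complement G) (opponent P) (flip_labels l) =
        optimum (opponent P) (?h ` ?U)"
      unfolding game_value.simps[of "complement G" "opponent P"] using fin False by simp
    also have "?h ` ?U = (\<lambda>x. ?c - x) ` (?g ` ?U)"
      unfolding image_image using step by (intro image_cong refl)
    also have "optimum (opponent P) \<dots> = ?c - optimum P (?g ` ?U)"
      using fin False by (intro optimum_reflect) auto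
    also have "optimum P (?g ` ?U) = game_value G P l"
      unfolding game_value.simps[of G P l] using fin False by simp
    finally show ?thesis by simp
  qed
qed

lemma balance_A_add_balance_I_complement:
  assumes "finite_simple_graph G"
  shows "balance_A G + balance_I (complement G) = int (card (verts G) div 2)"
  using game_value_add_complement[of G Map.empty Admirable] assms
  by (simp add: balance_A_def balance_I_def class_size_def)

section \<open>Complement of the random graph\<close>

lemma map_pmf_Not_bernoulli_half:
  "map_pmf Not (bernoulli_pmf (1/2)) = bernoulli_pmf (1/2)"
proof -
  have "bij Not" by (rule involuntory_imp_bij) simp
  then show ?thesis
    by (simp add: bernoulli_pmf_half_conv_pmf_of_set map_pmf_of_set_bij_betw)
qed

lemma map_pmf_complement_random_graph:
  "map_pmf complement (random_graph n (1/2)) = random_graph n (1/2)"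
proof -
  let ?N = "[{1..n}]\<^bsup>2\<^esup>"
  let ?\<Pi> = "\<lambda>d. Pi_pmf ?N d (\<lambda>_. bernoulli_pmf (1/2))"
  let ?graph = "\<lambda>X. \<lparr>verts = {1..n}, edges = {e \<in> ?N. X e}\<rparr>"
  have fin: "finite ?N" by (simp add: finite_imp_finite_nsets)
  \<comment> \<open>Negation also acts on the default value outside the index set, so the coins to
    be negated must have default \<open>True\<close>.\<close>
  have "?\<Pi> False = map_pmf (\<lambda>X. Not \<circ> X) (?\<Pi> True)"
    using Pi_pmf_map[OF fin, of Not True False "\<lambda>_. bernoulli_pmf (1/2)"]
    by (simp add: map_pmf_Not_bernoulli_half)
  also have "?\<Pi> True = map_pmf (\<lambda>X e. if e \<in> ?N then X e else True) (?\<Pi> False)"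
    by (rule Pi_pmf_default_swap[OF fin, symmetric])
  finally have "map_pmf ?graph (?\<Pi> False) = map_pmf ?graph (map_pmf (\<lambda>X. Not \<circ> X)
      (map_pmf (\<lambda>X e. if e \<in> ?N then X e else True) (?\<Pi> False)))"
    by (rule arg_cong)
  then have "random_graph n (1/2) =
      map_pmf (\<lambda>X. ?graph (Not \<circ> (\<lambda>e. if e \<in> ?N then X e else True))) (?\<Pi> False)"
    unfolding random_graph_def pmf.map_comp o_def .
  \<comment> \<open>The graph reads only values on \<open>?N\<close>, where the default is
    irrelevant and negated coins select the missing edges.\<close>
  also have "\<dots> = map_pmf (\<lambda>X. complement (?graph X)) (?\<Pi> False)"
    by (intro map_pmf_cong refl) (auto simp: complement_def)
  also have "\<dots> = map_pmf complement (random_graph n (1/2))"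
    by (simp add: random_graph_def pmf.map_comp o_def)
  finally show ?thesis ..
qed

text \<open>Finite support makes every real function of the random graph integrable, as linearity of
  expectation requires.\<close>

lemma finite_set_pmf_random_graph: "finite (set_pmf (random_graph n p))"
proof (rule finite_subset)
  show "set_pmf (random_graph n p) \<subseteq>
      (\<lambda>E. \<lparr>verts = {1..n}, edges = E\<rparr>) ` Pow ([{1..n}]\<^bsup>2\<^esup>)"
    by (auto simp: random_graph_def)
qed (simp add: finite_imp_finite_nsets)

theorem theorem3p5:
  fixes n :: nat
  shows "measure_pmf.expectation (random_graph n (1/2))
           (\<lambda>G. real_of_int (balance_A G + balance_I G)) = real_of_int \<lfloor>real n / 2\<rfloor>
       \<and> measure_pmf.expectation (random_graph n (1/2))
           (\<lambda>G. real_of_int (balance_A G + balance_I (complement G))) = real_of_int \<lfloor>real n / 2\<rfloor>"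
proof -
  let ?R = "random_graph n (1/2)"
  let ?E = "measure_pmf.expectation ?R"
  have int: "integrable (measure_pmf ?R) f" for f :: "nat graph \<Rightarrow> real"
    by (rule integrable_measure_pmf_finite[OF finite_set_pmf_random_graph])
  have "?E (\<lambda>G. real_of_int (balance_A G + balance_I (complement G))) =
      ?E (\<lambda>_. real (n div 2))"
  \<comment> \<open>The integrand is constant on the support, by the identity for single
    graphs.\<close>
  proof (intro integral_cong_AE AE_pmfI)
    fix G assume G: "G \<in> set_pmf ?R"
    then have "verts G = {1..n}" by (auto simp: random_graph_def)
    then show "real_of_int (balance_A G + balance_I (complement G)) = real (n div 2)"
      using balance_A_add_balance_I_complement[OF finite_simple_graph_random_graph[OF G]]
      by simp
  qed auto
  also have "\<dots> = real_of_int \<lfloor>real n / 2\<rfloor>"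
    by (simp add: floor_divide_of_nat_eq[of n 2, simplified])
  finally have second: "?E (\<lambda>G. real_of_int (balance_A G + balance_I (complement G))) =
    real_of_int \<lfloor>real n / 2\<rfloor>" .
  \<comment> \<open>The sum \<open>balance_A G + balance_I G\<close> need not be constant; only the
    expectation of its second term is unchanged by complementation, and linearity does the
    rest.\<close>
  have "?E (\<lambda>G. real_of_int (balance_I G)) =
      measure_pmf.expectation (map_pmf complement ?R) (\<lambda>G. real_of_int (balance_I G))"
    by (simp add: map_pmf_complement_random_graph)
  also have "\<dots> = ?E (\<lambda>G. real_of_int (balance_I (complement G)))"
    by (rule integral_map_pmf)
  finally have "?E (\<lambda>G. real_of_int (balance_A G + balance_I G)) =
      ?E (\<lambda>G. real_of_int (balance_A G + balance_I (complement G)))"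
    by (simp add: int)
  with second show ?thesis by simp
qed

end
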